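(* If $G$ is a connected graph of tree-width at most $k$ and order at least $2$, where $k$ is an integer, then \[ \operatorname{lpt}(G)\leq 3k\log |V(G)| . \]
   Context: All graphs are simple, finite, and undirected; the order of a graph (or of a path) is its number of vertices. A longest path of a graph $G$ is a path in $G$ of maximum order among all paths in $G$. A longest path transversal of $G$ is a set of vertices of $G$ that intersects the vertex set of every longest path of $G$. $\operatorname{lpt}(G)$ denotes the minimum cardinality of a longest path transversal of $G$. Tree-width has its standard meaning (the minimum over all tree decompositions of the maximum bag size minus one). Here $\log$ denotes the natural logarithm. *)

theory Defs
  imports Complex_Main "Graph_Theory.Graph_Theory"
begin

text \<open>
  A simple finite undirected graph is a \<^locale>\<open>pair_graph\<close>: a finite, loop-free digraph
  whose arcs are ordered pairs and whose arc relation is symmetric.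
  The name \<^const>\<open>Digraph_Component.connected\<close> is written with its theory prefix because
  of the homonymous topological notion.
\<close>

subsection \<open>Longest path transversals\<close>

text \<open>A path is given by its list of vertices, so its order is the length of the list.\<close>

definition longest_path :: "'a pair_pre_digraph \<Rightarrow> 'a list \<Rightarrow> bool" where
  "longest_path G p \<longleftrightarrow>
     vpath p (with_proj G) \<and> (\<forall>q. vpath q (with_proj G) \<longrightarrow> length q \<le> length p)"

definition longest_path_transversal :: "'a pair_pre_digraph \<Rightarrow> 'a set \<Rightarrow> bool" where
  "longest_path_transversal G S \<longleftrightarrow>
     S \<subseteq> pverts G \<and> (\<forall>p. longest_path G p \<longrightarrow> S \<inter> set p \<noteq> {})"

definition lpt :: "'a pair_pre_digraph \<Rightarrow> nat" where
  "lpt G = (LEAST n. \<exists>S. longest_path_transversal G S \<and> card S = n)"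

subsection \<open>Tree-width\<close>

text \<open>
  The library's \<^const>\<open>Digraph_Component.tree\<close> cannot be used for undirected graphs represented
  as symmetric digraphs: there every edge \<open>ab\<close> yields the directed cycle \<open>a, b, a\<close>, so that no
  tree could have an edge. Cycles of an undirected graph are the directed cycles with at least
  three arcs.
\<close>

definition undirected_tree :: "'t pair_pre_digraph \<Rightarrow> bool" where
  "undirected_tree T \<longleftrightarrow>
     pair_graph T \<and> Digraph_Component.connected (with_proj T) \<and>
     \<not> (\<exists>c. pre_digraph.cycle (with_proj T) c \<and> 3 \<le> length c)"

text \<open>
  Since \<^const>\<open>Digraph_Component.connected\<close> excludes the null graph, trees have at least one
  node.
\<close>

definition tree_decomposition ::
  "'a pair_pre_digraph \<Rightarrow> 't pair_pre_digraph \<Rightarrow> ('t \<Rightarrow> 'a set) \<Rightarrow> bool" where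
  "tree_decomposition G T B \<longleftrightarrow>
     undirected_tree T \<and>
     (\<Union>t\<in>pverts T. B t) = pverts G \<and>
     (\<forall>(u, v)\<in>parcs G. \<exists>t\<in>pverts T. u \<in> B t \<and> v \<in> B t) \<and>
     (\<forall>v\<in>pverts G.
        Digraph_Component.connected (with_proj T \<restriction> {t \<in> pverts T. v \<in> B t}))"

definition td_width :: "'t pair_pre_digraph \<Rightarrow> ('t \<Rightarrow> 'a set) \<Rightarrow> int" where
  "td_width T B = int (Max ((\<lambda>t. card (B t)) ` pverts T)) - 1"

text \<open>
  Decomposition trees are finite, so it is no restriction to let their nodes be natural numbers.
  The width is an integer, as it is \<open>- 1\<close> for the null graph.
\<close>

definition treewidth :: "'a pair_pre_digraph \<Rightarrow> int" where
  "treewidth G =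
     (LEAST w. \<exists>(T :: nat pair_pre_digraph) B. tree_decomposition G T B \<and> td_width T B = w)"

end

theory Submission
  imports Defs "HOL-Analysis.Harmonic_Numbers"
begin

text \<open>
  The bound holds because a single bag of any tree decomposition already meets all longest paths,
  whence \<open>lpt G \<le> treewidth G + 1\<close>. Two facts combine to give this.

  First, any two longest paths of a connected graph share a vertex
  (\<open>longest_paths_intersect\<close>): otherwise, a shortest connection between them, extended at either
  end by the longer part of the path that it hits, would be a longer path.

  Second, subtrees of a tree have the Helly property (\<open>helly_connected_sets\<close>). The nodes whose
  bags meet a given path form a subtree (\<open>connected_nodes_meeting_path\<close>), and the subtrees of two
  longest paths have a common node, namely any node whose bag contains a common vertex of the paths.
  So all these subtrees have a common node, and its bag is a transversal.

  The logarithm enters only through \<open>ln \<bar>V(G)\<bar> \<ge> ln 2 \<ge> 2/3\<close>. As a connected graph of order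
  at least 2 has an edge, \<open>k \<ge> 1\<close>, and therefore \<open>k + 1 \<le> 2 k \<le> 3 k ln 2\<close>.
\<close>

section \<open>Walks as lists of vertices\<close>

abbreviation walk :: "'v rel \<Rightarrow> 'v list \<Rightarrow> bool" where
  "walk E \<equiv> successively (\<lambda>x y. (x, y) \<in> E)"

text \<open>
  The library's \<^const>\<open>rtrancl_on\<close> is reachability by walks that stay inside a given set, so one
  fixed edge relation serves for a graph and all its induced subgraphs.
\<close>

definition connected_set :: "'v rel \<Rightarrow> 'v set \<Rightarrow> bool" where
  "connected_set E X \<longleftrightarrow> (\<forall>a\<in>X. \<forall>b\<in>X. (a, b) \<in> rtrancl_on X E)"

lemma connected_setD:
  "connected_set E X \<Longrightarrow> X \<subseteq> Y \<Longrightarrow> a \<in> X \<Longrightarrow> b \<in> X \<Longrightarrow> (a, b) \<in> rtrancl_on Y E"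
  unfolding connected_set_def by (blast intro: rtrancl_on_mono)

lemma connected_set_Un:
  assumes "connected_set E X" "connected_set E Y" "X \<inter> Y \<noteq> {}"
  shows "connected_set E (X \<union> Y)"
proof -
  from assms(3) obtain c where c: "c \<in> X" "c \<in> Y" by blast
  have to_c: "(a, c) \<in> rtrancl_on (X \<union> Y) E \<and> (c, a) \<in> rtrancl_on (X \<union> Y) E"
    if "a \<in> X \<union> Y" for a
    using that c connected_setD[OF assms(1), of "X \<union> Y"] connected_setD[OF assms(2), of "X \<union> Y"]
    by blast
  then show ?thesis
    unfolding connected_set_def by (blast intro: rtrancl_on_trans)
qed

lemma walk_rev: "sym E \<Longrightarrow> walk E (rev p) \<longleftrightarrow> walk E p"
proof -
  assume "sym E"
  then have swap: "(\<lambda>x y. (y, x) \<in> E) = (\<lambda>x y. (x, y) \<in> E)"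
    by (auto simp: fun_eq_iff sym_def)
  show ?thesis unfolding successively_rev swap ..
qed

lemma set_vwalk_arcs_subset_iff_walk: "set (vwalk_arcs p) \<subseteq> E \<longleftrightarrow> walk E p"
  by (induction p rule: vwalk_arcs.induct) auto

lemma vpath_with_proj_iff:
  "vpath p (with_proj G) \<longleftrightarrow> p \<noteq> [] \<and> set p \<subseteq> pverts G \<and> walk (parcs G) p \<and> distinct p"
  by (auto simp: vpath_def vwalk_def set_vwalk_arcs_subset_iff_walk)

lemma rtrancl_on_imp_distinct_walk:
  assumes "(a, b) \<in> rtrancl_on X E"
  shows "\<exists>p. p \<noteq> [] \<and> hd p = a \<and> last p = b \<and> distinct p \<and> set p \<subseteq> X \<and> walk E p"
  using assms
proof (induction rule: converse_rtrancl_on_induct)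
  case base
  then show ?case by (intro exI[of _ "[b]"]) auto
next
  case (step x y)
  then obtain p where p: "p \<noteq> []" "hd p = y" "last p = b" "distinct p" "set p \<subseteq> X" "walk E p"
    by blast
  show ?case
  proof (cases "x \<in> set p")
    case True
    then obtain p1 p2 where "p = p1 @ x # p2" by (auto simp: in_set_conv_decomp)
    with p show ?thesis
      by (intro exI[of _ "x # p2"]) (auto simp: successively_append_iff)
  next
    case False
    with p step.hyps show ?thesis
      by (intro exI[of _ "x # p"]) (auto simp: successively_Cons)
  qed
qed

text \<open>
  A shortest walk from \<open>A\<close> to \<open>B\<close> meets these sets in its ends only: an inner vertex in \<open>A\<close> or
  \<open>B\<close> would allow a shortcut.
\<close>

lemma walk_between_disjoint_sets:
  assumes "(a, b) \<in> rtrancl_on X E" "a \<in> A" "b \<in> B" "A \<inter> B = {}"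
  obtains x m y where "x \<in> A" "y \<in> B" "distinct (x # m @ [y])" "set (x # m @ [y]) \<subseteq> X"
    "walk E (x # m @ [y])" "set m \<inter> (A \<union> B) = {}"
proof -
  define good where "good p \<longleftrightarrow>
    p \<noteq> [] \<and> hd p \<in> A \<and> last p \<in> B \<and> distinct p \<and> set p \<subseteq> X \<and> walk E p" for p
  from rtrancl_on_imp_distinct_walk[OF assms(1)] assms(2,3) have "\<exists>p. good p"
    unfolding good_def by blast
  then obtain p where p: "good p" and least: "\<And>q. good q \<Longrightarrow> length p \<le> length q"
    using ex_has_least_nat[of good _ length] by blast
  from p assms(4) have "p \<noteq> []" "hd p \<noteq> last p" unfolding good_def by auto
  then obtain x m y where pm: "p = x # m @ [y]"
    by (cases p; cases "tl p" rule: rev_cases) auto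
  have "z \<notin> A" if z: "z \<in> set m" for z
  proof
    assume "z \<in> A"
    from z obtain m1 m2 where m: "m = m1 @ z # m2" by (auto simp: in_set_conv_decomp)
    have "good (z # m2 @ [y])"
      using p \<open>z \<in> A\<close> unfolding good_def pm m
      by (auto simp: successively_append_iff successively_Cons)
    from least[OF this] show False unfolding pm m by simp
  qed
  moreover have "z \<notin> B" if z: "z \<in> set m" for z
  proof
    assume "z \<in> B"
    from z obtain m1 m2 where m: "m = m1 @ z # m2" by (auto simp: in_set_conv_decomp)
    have "good (x # m1 @ [z])"
      using p \<open>z \<in> B\<close> unfolding good_def pm m
      by (cases m1) (auto simp: successively_append_iff successively_Cons hd_append)
    from least[OF this] show False unfolding pm m by simp
  qed
  ultimately show thesis
    using that[of x y m] p unfolding good_def pm by auto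
qed

section \<open>Longest paths pairwise intersect\<close>

text \<open>
  The vertex \<open>x\<close> cuts the path into two parts that both contain \<open>x\<close>. Their lengths add up to
  one more than that of the path, so that one of them has more than half of its vertices. This
  strict inequality is what makes the path glued from two such halves too long.
\<close>

lemma half_path_ending_at:
  assumes "sym E" "walk E p" "distinct p" "x \<in> set p"
  obtains l where "l \<noteq> []" "last l = x" "walk E l" "distinct l" "set l \<subseteq> set p"
    "length p < 2 * length l"
proof -
  from assms(4) obtain p1 p2 where p: "p = p1 @ x # p2" by (auto simp: in_set_conv_decomp)
  have "walk E (p1 @ [x])" "walk E (x # p2)"
    using assms(2) unfolding p by (auto simp: successively_append_iff)
  moreover from walk_rev[OF assms(1), of "x # p2"] calculation(2)
  have "walk E (rev p2 @ [x])" by simp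
  moreover consider "length p < 2 * length (p1 @ [x])" | "length p < 2 * length (rev p2 @ [x])"
    unfolding p by fastforce
  ultimately show thesis
    using that[of "p1 @ [x]"] that[of "rev p2 @ [x]"] assms(3) unfolding p by cases auto
qed

lemma longest_paths_intersect:
  assumes G: "pair_graph G" and conn: "connected_set (parcs G) (pverts G)"
    and p: "longest_path G p" and q: "longest_path G q"
  shows "set p \<inter> set q \<noteq> {}"
proof
  assume disj: "set p \<inter> set q = {}"
  let ?E = "parcs G"
  interpret pair_graph G by fact
  have sym: "sym ?E" using pair_sym_arcs by (simp add: symmetric_def)
  have P: "p \<noteq> []" "set p \<subseteq> pverts G" "walk ?E p" "distinct p"
    and Q: "q \<noteq> []" "set q \<subseteq> pverts G" "walk ?E q" "distinct q"
    and max: "\<And>r. vpath r (with_proj G) \<Longrightarrow> length r \<le> length p"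
             "\<And>r. vpath r (with_proj G) \<Longrightarrow> length r \<le> length q"
    using p q unfolding longest_path_def vpath_with_proj_iff by auto
  have "(hd p, hd q) \<in> rtrancl_on (pverts G) ?E"
    using connected_setD[OF conn order.refl] P Q by (meson hd_in_set subsetD)
  then obtain x m y where xy: "x \<in> set p" "y \<in> set q" and m: "distinct (x # m @ [y])"
      "set (x # m @ [y]) \<subseteq> pverts G" "walk ?E (x # m @ [y])" "set m \<inter> (set p \<union> set q) = {}"
    using P(1) Q(1) disj by (elim walk_between_disjoint_sets[of _ _ _ _ "set p" "set q"]) auto
  obtain l where l: "l \<noteq> []" "last l = x" "walk ?E l" "distinct l" "set l \<subseteq> set p"
    "length p < 2 * length l"
    using half_path_ending_at[OF sym P(3,4) xy(1)] .
  obtain r where r: "r \<noteq> []" "last r = y" "walk ?E r" "distinct r" "set r \<subseteq> set q"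
    "length q < 2 * length r"
    using half_path_ending_at[OF sym Q(3,4) xy(2)] .
  have "walk ?E (l @ m @ rev r)"
    using l r m(3) walk_rev[OF sym, of r]
    by (cases m) (auto simp: successively_append_iff successively_Cons hd_append hd_rev)
  moreover have "distinct (l @ m @ rev r)"
    using l r m disj by auto
  moreover have "set (l @ m @ rev r) \<subseteq> pverts G"
    using l r m P Q by auto
  ultimately have "vpath (l @ m @ rev r) (with_proj G)"
    using l(1) by (auto simp: vpath_with_proj_iff)
  from max[OF this] l(6) r(6) show False by simp
qed

section \<open>The Helly property of subtrees\<close>

lemma pcas_vwalk_arcs:
  "p \<noteq> [] \<Longrightarrow> pcas (hd p) (vwalk_arcs p) (last p) \<and> pawalk_verts (hd p) (vwalk_arcs p) = p"
  by (induction p rule: vwalk_arcs.induct) auto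

text \<open>
  A walk between two neighbours of \<open>t\<close> that avoids \<open>t\<close> would close to a cycle through \<open>t\<close>. This
  is the only consequence of acyclicity that the Helly property needs.
\<close>

lemma undirected_tree_separates_neighbours:
  assumes T: "undirected_tree T" and E: "(t, u) \<in> parcs T" "(t, v) \<in> parcs T" and "u \<noteq> v"
  shows "(u, v) \<notin> rtrancl_on (pverts T - {t}) (parcs T)"
proof
  assume "(u, v) \<in> rtrancl_on (pverts T - {t}) (parcs T)"
  then obtain p where p: "p \<noteq> []" "hd p = u" "last p = v" "distinct p"
      "set p \<subseteq> pverts T - {t}" "walk (parcs T) p"
    using rtrancl_on_imp_distinct_walk by metis
  from T interpret pair_graph T by (simp add: undirected_tree_def)
  let ?c = "t # p @ [t]"
  have "walk (parcs T) ?c"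
    using p E pair_sym_arcs
    by (auto simp: successively_append_iff successively_Cons symmetric_def dest: symD)
  then have "set (vwalk_arcs ?c) \<subseteq> parcs T"
    by (simp only: set_vwalk_arcs_subset_iff_walk)
  moreover have "pcas t (vwalk_arcs ?c) t" "pawalk_verts t (vwalk_arcs ?c) = ?c"
    using pcas_vwalk_arcs[of ?c] by auto
  ultimately have "cycle (vwalk_arcs ?c)"
    unfolding cycle_def awalk_def using p E in_arcsD1 by (auto intro!: exI[of _ t])
  moreover from p \<open>u \<noteq> v\<close> have "2 \<le> length p"
    by (cases p; cases "tl p") auto
  then have "3 \<le> length (vwalk_arcs ?c)"
    using vwalk_length_simp[of ?c] unfolding vwalk_length_def by simp
  ultimately show False using T unfolding undirected_tree_def by blast
qed

text \<open>
  Suppose that every node \<open>t\<close> is avoided by some member \<open>S\<close> of the family. Being connected, \<open>S\<close>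
  lies in one component of \<open>V - {t}\<close>. Choose \<open>t\<close> and \<open>S\<close> such that this component \<open>K\<close> is smallest,
  and let \<open>u\<close> be a neighbour of \<open>t\<close> in \<open>K\<close>. A member \<open>S'\<close> that avoids \<open>u\<close> meets \<open>S\<close>, hence
  \<open>K\<close>. As \<open>u\<close> is the only neighbour of \<open>t\<close> in \<open>K\<close>, the component of \<open>V - {u}\<close> that contains
  \<open>S'\<close> cannot leave \<open>K\<close> through \<open>t\<close>. So it lies in \<open>K - {u}\<close>, against minimality.
\<close>

lemma helly_connected_sets:
  assumes "finite V" "V \<noteq> {}" "sym E" "connected_set E V"
    and sep: "\<And>t u v. (t, u) \<in> E \<Longrightarrow> (t, v) \<in> E \<Longrightarrow> u \<noteq> v \<Longrightarrow> (u, v) \<notin> rtrancl_on (V - {t}) E"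
    and F: "\<And>S. S \<in> F \<Longrightarrow> S \<subseteq> V \<and> connected_set E S"
    and meet: "\<And>S S'. S \<in> F \<Longrightarrow> S' \<in> F \<Longrightarrow> S \<inter> S' \<noteq> {}"
  shows "\<exists>t\<in>V. \<forall>S\<in>F. t \<in> S"
proof (rule ccontr)
  assume "\<not> ?thesis"
  then have avoid: "\<exists>S\<in>F. t \<notin> S" if "t \<in> V" for t using that by blast
  define comp where "comp t x = {y. (x, y) \<in> rtrancl_on (V - {t}) E}" for t x
  have comp_sub: "comp t x \<subseteq> V - {t}" for t x
    unfolding comp_def using in_rtrancl_on_in_F(2) by fastforce
  have in_comp: "S \<subseteq> comp t x" if "S \<in> F" "t \<notin> S" "x \<in> S" for S t x
    unfolding comp_def using that F[of S] connected_setD[of E S "V - {t}" x] by blast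
  have rsym: "(b, a) \<in> rtrancl_on X E" if "(a, b) \<in> rtrancl_on X E" for a b X
    using rtrancl_on_sym[OF \<open>sym E\<close>] that by (rule symD)
  have comp_step: "z \<in> comp t x" if "y \<in> comp t x" "(y, z) \<in> E" "z \<in> V - {t}" for t x y z
    using that comp_sub unfolding comp_def by (blast intro: rtrancl_on_into_rtrancl_on)
  have comp_back: "y \<in> comp t x" if "z \<in> comp t x" "(y, z) \<in> E" "y \<in> V - {t}" for t x y z
    using comp_step that \<open>sym E\<close> by (meson symD)
  have False if "t \<in> V" "S \<in> F" "t \<notin> S" "x \<in> S" for t S x
    using that
  proof (induction "card (comp t x)" arbitrary: t S x rule: less_induct)
    case less
    let ?K = "comp t x"
    have K: "S \<subseteq> ?K" using in_comp less.prems by blast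
    have "x \<in> V" using less.prems F by blast
    then have "(t, x) \<in> rtrancl_on V E"
      using connected_setD[OF assms(4) order.refl less.prems(1)] by blast
    moreover have "y \<in> ?K \<longrightarrow> (\<exists>u\<in>?K. (t, u) \<in> E)" if "(t, y) \<in> rtrancl_on V E" for y
      using that
    proof (induction rule: rtrancl_on_induct)
      case base
      show ?case using comp_sub by blast
    next
      case (step y z)
      then show ?case using comp_back[of z t x y] by blast
    qed
    ultimately obtain u where u: "u \<in> ?K" "(t, u) \<in> E" using K less.prems by blast
    then have "u \<in> V" "u \<noteq> t" using comp_sub by blast+
    obtain S' where S': "S' \<in> F" "u \<notin> S'" using avoid[OF \<open>u \<in> V\<close>] by blast
    obtain z where z: "z \<in> S" "z \<in> S'" using meet[OF less.prems(2) S'(1)] by blast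
    \<comment> \<open>The edge \<open>tu\<close> is the only way into \<open>K\<close> from outside, so that a walk from \<open>t\<close> that
      avoids \<open>u\<close> never enters \<open>K\<close>.\<close>
    have "y \<notin> ?K" if "(t, y) \<in> rtrancl_on (V - {u}) E" for y
      using that
    proof (induction rule: rtrancl_on_induct)
      case base
      show ?case using comp_sub by blast
    next
      case (step y w)
      show ?case
      proof
        assume w: "w \<in> ?K"
        then have "y = t" using comp_back[OF w] step by blast
        have "(u, w) \<in> rtrancl_on (V - {t}) E"
          using u(1) w rsym unfolding comp_def by (blast intro: rtrancl_on_trans)
        then show False using sep[of t u w] u(2) step \<open>y = t\<close> by blast
      qed
    qed
    then have t: "t \<notin> comp u z" using z K rsym unfolding comp_def by blast
    \<comment> \<open>Since \<open>K\<close> is a component of \<open>V - {t}\<close>, a walk that starts in \<open>K\<close> can leave it only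
      through \<open>t\<close>.\<close>
    have "y \<in> ?K" if "(z, y) \<in> rtrancl_on (V - {u}) E" for y
      using that
    proof (induction rule: rtrancl_on_induct)
      case base
      show ?case using z K by blast
    next
      case (step y w)
      then have "w \<in> comp u z" unfolding comp_def by (blast intro: rtrancl_on_into_rtrancl_on)
      with t have "w \<noteq> t" by blast
      with step show ?case using comp_step[of y t x w] by blast
    qed
    then have "comp u z \<subset> ?K" using u(1) comp_sub[of u z] unfolding comp_def by blast
    moreover have "finite ?K" using comp_sub \<open>finite V\<close> by (meson finite_Diff finite_subset)
    ultimately have "card (comp u z) < card ?K" by (simp add: psubset_card_mono)
    then show False using less.hyps \<open>u \<in> V\<close> S' z by blast
  qed
  moreover obtain t where "t \<in> V" using \<open>V \<noteq> {}\<close> by blast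
  moreover obtain S where "S \<in> F" "t \<notin> S" using avoid[OF \<open>t \<in> V\<close>] by blast
  moreover have "S \<noteq> {}" using meet[OF \<open>S \<in> F\<close> \<open>S \<in> F\<close>] by blast
  ultimately show False by blast
qed

section \<open>Tree decompositions\<close>

lemma connected_with_proj_imp_connected_set:
  assumes "sym (parcs G)" "Digraph_Component.connected (with_proj G)"
  shows "connected_set (parcs G) (pverts G)" "pverts G \<noteq> {}"
proof -
  have "parcs (mk_symmetric (with_proj G)) = parcs G"
    using assms(1) by (fastforce simp: mk_symmetric_def sym_def)
  with assms show "connected_set (parcs G) (pverts G)" "pverts G \<noteq> {}"
    unfolding Digraph_Component.connected_def strongly_connected_def connected_set_def
      reachable_def by (auto simp: mk_symmetric_def)
qed

lemma connected_induced_imp_connected_set: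
  assumes "sym (parcs G)" "Digraph_Component.connected (with_proj G \<restriction> X)"
  shows "connected_set (parcs G) X"
proof -
  have "parcs (mk_symmetric (with_proj G \<restriction> X)) \<subseteq> parcs G"
    using assms(1) by (auto simp: mk_symmetric_def induce_subgraph_def sym_def)
  moreover have "(a, b) \<in> rtrancl_on X (parcs (mk_symmetric (with_proj G \<restriction> X)))"
    if "a \<in> X" "b \<in> X" for a b
    using assms(2) that
    unfolding Digraph_Component.connected_def strongly_connected_def reachable_def
    by (simp add: mk_symmetric_def)
  ultimately show ?thesis
    unfolding connected_set_def by (meson order.refl rtrancl_on_mono)
qed

text \<open>
  The nodes whose bags contain a given vertex form a subtree, and the subtrees of two consecutive
  vertices of the path overlap, because some bag contains the edge between them.
\<close>

lemma connected_nodes_meeting_path: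
  assumes T: "tree_decomposition G T B"
    and p: "p \<noteq> []" "set p \<subseteq> pverts G" "walk (parcs G) p"
  shows "connected_set (parcs T) {t \<in> pverts T. B t \<inter> set p \<noteq> {}}"
  using p
proof (induction p rule: induct_list012)
  case (2 v)
  from T interpret T: pair_graph T by (simp add: tree_decomposition_def undirected_tree_def)
  have sym: "sym (parcs T)" using T.pair_sym_arcs by (simp add: symmetric_def)
  show ?case
    using T 2 connected_induced_imp_connected_set[OF sym]
    unfolding tree_decomposition_def by auto
next
  case (3 v w p)
  from T interpret T: pair_graph T by (simp add: tree_decomposition_def undirected_tree_def)
  have sym: "sym (parcs T)" using T.pair_sym_arcs by (simp add: symmetric_def)
  have "connected_set (parcs T) {t \<in> pverts T. v \<in> B t}"
    using T 3 connected_induced_imp_connected_set[OF sym]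
    unfolding tree_decomposition_def by auto
  moreover have "connected_set (parcs T) {t \<in> pverts T. B t \<inter> set (w # p) \<noteq> {}}"
    using 3 by auto
  moreover have "(v, w) \<in> parcs G" using 3 by simp
  then have "{t \<in> pverts T. v \<in> B t} \<inter> {t \<in> pverts T. B t \<inter> set (w # p) \<noteq> {}} \<noteq> {}"
    using T unfolding tree_decomposition_def by fastforce
  ultimately have "connected_set (parcs T)
      ({t \<in> pverts T. v \<in> B t} \<union> {t \<in> pverts T. B t \<inter> set (w # p) \<noteq> {}})"
    by (rule connected_set_Un)
  moreover have "{t \<in> pverts T. v \<in> B t} \<union> {t \<in> pverts T. B t \<inter> set (w # p) \<noteq> {}}
      = {t \<in> pverts T. B t \<inter> set (v # w # p) \<noteq> {}}" by auto
  ultimately show ?case by simp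
qed simp

lemma bag_longest_path_transversal:
  assumes G: "pair_graph G" "Digraph_Component.connected (with_proj G)"
    and T: "tree_decomposition G T B"
  shows "\<exists>t\<in>pverts T. longest_path_transversal G (B t)"
proof -
  from T have tree: "undirected_tree T" by (simp add: tree_decomposition_def)
  from G interpret G: pair_graph G by simp
  from tree interpret T: pair_graph T by (simp add: undirected_tree_def)
  have symG: "sym (parcs G)" and symT: "sym (parcs T)"
    using G.pair_sym_arcs T.pair_sym_arcs by (simp_all add: symmetric_def)
  have connG: "connected_set (parcs G) (pverts G)"
    using connected_with_proj_imp_connected_set symG G by blast
  have connT: "connected_set (parcs T) (pverts T)" "pverts T \<noteq> {}"
    using connected_with_proj_imp_connected_set[OF symT] tree
    unfolding undirected_tree_def by blast+
  define nodes where "nodes p = {t \<in> pverts T. B t \<inter> set p \<noteq> {}}" for p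
  have path: "p \<noteq> [] \<and> set p \<subseteq> pverts G \<and> walk (parcs G) p" if "longest_path G p" for p
    using that unfolding longest_path_def vpath_with_proj_iff by blast
  have "\<exists>t\<in>pverts T. \<forall>S\<in>nodes ` {p. longest_path G p}. t \<in> S"
  proof (rule helly_connected_sets[OF T.pair_finite_verts connT(2) symT connT(1)])
    show "(u, v) \<notin> rtrancl_on (pverts T - {t}) (parcs T)"
      if "(t, u) \<in> parcs T" "(t, v) \<in> parcs T" "u \<noteq> v" for t u v
      using undirected_tree_separates_neighbours[OF tree that] .
    show "S \<subseteq> pverts T \<and> connected_set (parcs T) S"
      if "S \<in> nodes ` {p. longest_path G p}" for S
      using that path connected_nodes_meeting_path[OF T] unfolding nodes_def by auto
    show "S \<inter> S' \<noteq> {}"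
      if S: "S \<in> nodes ` {p. longest_path G p}" "S' \<in> nodes ` {p. longest_path G p}" for S S'
    proof -
      from S obtain p q where pq: "longest_path G p" "S = nodes p" "longest_path G q" "S' = nodes q"
        by blast
      obtain v where v: "v \<in> set p" "v \<in> set q"
        using longest_paths_intersect[OF G(1) connG pq(1,3)] by blast
      with path[OF pq(1)] have "v \<in> pverts G" by blast
      with T obtain t where "t \<in> pverts T" "v \<in> B t" unfolding tree_decomposition_def by blast
      with v pq show ?thesis unfolding nodes_def by blast
    qed
  qed
  then obtain t where "t \<in> pverts T" "\<And>p. longest_path G p \<Longrightarrow> t \<in> nodes p" by auto
  then have t: "t \<in> pverts T" "\<And>p. longest_path G p \<Longrightarrow> B t \<inter> set p \<noteq> {}"
    unfolding nodes_def by auto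
  moreover have "B t \<subseteq> pverts G" using T t(1) unfolding tree_decomposition_def by blast
  ultimately show ?thesis unfolding longest_path_transversal_def by blast
qed

lemma card_bag_le_td_width:
  assumes "tree_decomposition G T B" "t \<in> pverts T"
  shows "int (card (B t)) \<le> td_width T B + 1"
proof -
  from assms(1) interpret T: pair_graph T
    by (simp add: tree_decomposition_def undirected_tree_def)
  show ?thesis
    unfolding td_width_def using T.pair_finite_verts assms(2) by simp
qed

text \<open>
  This shows that the minimum in the definition of tree-width ranges over a nonempty set.
\<close>

lemma single_bag_tree_decomposition:
  assumes "pair_graph G"
  shows "tree_decomposition G \<lparr>pverts = {0 :: nat}, parcs = {}\<rparr> (\<lambda>_. pverts G)"
proof -
  interpret pair_graph G by fact
  let ?T = "\<lparr>pverts = {0 :: nat}, parcs = {}\<rparr>"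
  have conn: "Digraph_Component.connected H"
    if "verts H = {0::nat}" for H :: "(nat, nat \<times> nat) pre_digraph"
    using that unfolding Digraph_Component.connected_def strongly_connected_def reachable_def
    by (auto simp: mk_symmetric_def)
  have "pair_graph ?T" by unfold_locales (auto simp: symmetric_def sym_def)
  moreover have "\<not> pre_digraph.cycle (with_proj ?T) c" for c
    by (auto simp: pre_digraph.cycle_def pre_digraph.awalk_def)
  ultimately have "undirected_tree ?T"
    unfolding undirected_tree_def by (simp add: conn)
  then show ?thesis
    unfolding tree_decomposition_def by (auto intro!: conn dest: in_arcsD1 in_arcsD2)
qed

text \<open>
  A least element of a set of integers exists only if the set is nonempty and bounded below; widths
  are at least \<open>- 1\<close>, so minimising \<open>nat (w + 1)\<close> minimises the width \<open>w\<close>.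
\<close>

lemma treewidth_attained:
  assumes "pair_graph G"
  shows "\<exists>(T :: nat pair_pre_digraph) B. tree_decomposition G T B \<and> td_width T B = treewidth G"
proof -
  define P where "P w \<longleftrightarrow>
    (\<exists>(T :: nat pair_pre_digraph) B. tree_decomposition G T B \<and> td_width T B = w)" for w
  have "\<exists>w. P w" unfolding P_def using single_bag_tree_decomposition[OF assms] by blast
  then obtain w where w: "P w" "\<And>w'. P w' \<Longrightarrow> nat (w + 1) \<le> nat (w' + 1)"
    using ex_has_least_nat[of P _ "\<lambda>w. nat (w + 1)"] by blast
  moreover have "- 1 \<le> w'" if "P w'" for w' using that unfolding P_def td_width_def by auto
  ultimately have "(LEAST w. P w) = w" by (intro Least_equality) force+
  moreover have "treewidth G = (LEAST w. P w)" unfolding treewidth_def P_def ..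
  ultimately have "P (treewidth G)" using w(1) by simp
  then show ?thesis unfolding P_def .
qed

lemma td_width_pos_if_arc:
  assumes G: "pair_graph G" and T: "tree_decomposition G T B" and uv: "(u, v) \<in> parcs G"
  shows "1 \<le> td_width T B"
proof -
  interpret pair_graph G by fact
  from T uv obtain t where t: "t \<in> pverts T" "u \<in> B t" "v \<in> B t"
    unfolding tree_decomposition_def by blast
  have "B t \<subseteq> pverts G" using T t(1) unfolding tree_decomposition_def by blast
  then have "card {u, v} \<le> card (B t)"
    using t pair_finite_verts by (intro card_mono) (auto intro: finite_subset)
  moreover have "u \<noteq> v" using pair_no_loops[OF uv] by simp
  ultimately show ?thesis using card_bag_le_td_width[OF T t(1)] by simp
qed

lemma connected_imp_arc:
  assumes G: "pair_graph G" "Digraph_Component.connected (with_proj G)"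
    and "card (pverts G) \<ge> 2"
  shows "parcs G \<noteq> {}"
proof
  assume E: "parcs G = {}"
  obtain a b where ab: "a \<in> pverts G" "b \<in> pverts G" "a \<noteq> b"
  proof -
    have fin: "finite (pverts G)" using assms(3) by (intro card_ge_0_finite) simp
    show thesis
      using that assms(3) card_le_Suc0_iff_eq[OF fin] by fastforce
  qed
  have "connected_set (parcs G) (pverts G)"
    using E G by (intro connected_with_proj_imp_connected_set) (auto simp: sym_def)
  then have "(a, b) \<in> rtrancl_on (pverts G) {}" using ab E unfolding connected_set_def by simp
  then have "a = b" by (induction rule: rtrancl_on_induct) auto
  with ab show False by simp
qed

section \<open>The bound\<close>

lemma lpt_le_treewidth:
  assumes "pair_graph G" "Digraph_Component.connected (with_proj G)"
  shows "int (lpt G) \<le> treewidth G + 1"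
proof -
  obtain T :: "nat pair_pre_digraph" and B
    where T: "tree_decomposition G T B" "td_width T B = treewidth G"
    using treewidth_attained[OF assms(1)] by blast
  obtain t where t: "t \<in> pverts T" "longest_path_transversal G (B t)"
    using bag_longest_path_transversal[OF assms T(1)] by blast
  have "lpt G \<le> card (B t)" unfolding lpt_def using t(2) by (intro Least_le) blast
  with card_bag_le_td_width[OF T(1) t(1)] T(2) show ?thesis by linarith
qed

theorem proposition6:
  fixes G :: "'a pair_pre_digraph" and k :: int
  assumes "pair_graph G"
    and "Digraph_Component.connected (with_proj G)"
    and "card (pverts G) \<ge> 2"
    and "treewidth G \<le> k"
  shows "real (lpt G) \<le> 3 * real_of_int k * ln (real (card (pverts G)))"
proof -
  obtain u v where "(u, v) \<in> parcs G" using connected_imp_arc[OF assms(1-3)] by auto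
  then have "1 \<le> treewidth G"
    using treewidth_attained[OF assms(1)] td_width_pos_if_arc[OF assms(1)] by metis
  with assms(4) have k: "1 \<le> k" by simp
  have "int (lpt G) \<le> k + 1" using lpt_le_treewidth[OF assms(1,2)] assms(4) by simp
  then have "real (lpt G) \<le> 2 * real_of_int k" using k by linarith
  also have "\<dots> \<le> 2 * real_of_int k * (3 / 2 * ln 2)"
    using k ln2_ge_two_thirds by simp
  also have "\<dots> = 3 * real_of_int k * ln 2" by simp
  also have "\<dots> \<le> 3 * real_of_int k * ln (real (card (pverts G)))"
    using k assms(3) by (intro mult_left_mono) auto
  finally show ?thesis .
qed

end
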